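(* Let $\psi:\mathrm{S}\to\mathrm{End}_{\mathrm{S}}(\mathrm{S}^-_{\mathrm{S}})$ be the algebra homomorphism $x\mapsto\psi_x$, where $\psi_x(y)=xy$ for $y\in\mathrm{S}^-$. Then $\psi$ is an isomorphism if and only if $n\geq d$.
   Context: $F$ is a field of characteristic different from $2$ and $n,d$ are positive integers. The symmetric group $\mathbf{S}_d$ acts on $(F^n)^{\otimes d}$ by permuting tensor factors, and $\mathrm{sgn}$ is its sign character. $\mathrm{S}=\mathrm{S}_F(n,d)=\mathrm{End}_{\mathbf{S}_d}((F^n)^{\otimes d})$ is the Schur algebra and $\mathrm{S}^-=\mathrm{S}^-_F(n,d)=\mathrm{Hom}_{\mathbf{S}_d}((F^n)^{\otimes d},(F^n)^{\otimes d}\otimes\mathrm{sgn})$, an $(\mathrm{S},\mathrm{S})$-bimodule under composition. $\mathrm{S}^-_{\mathrm{S}}$ denotes $\mathrm{S}^-$ regarded as a right $\mathrm{S}$-module. *)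

theory Defs
  imports
    "HOL-Analysis.Cartesian_Space"
    "HOL-Combinatorics.Permutations"
    "HOL-Algebra.QuotRing"
    "HOL-Algebra.Module"
begin

section \<open>Tensor powers\<close>

text \<open>The integers \<open>n\<close> and \<open>d\<close> are the cardinalities of finite types \<open>'n\<close> and \<open>'d\<close>: \<open>F\<^sup>n\<close> is
  \<open>'a ^ 'n\<close>, and \<open>'d\<close> indexes the tensor factors.  An element of the \<open>d\<close>-th tensor power of
  \<open>F\<^sup>n\<close> is given by its coordinates with respect to the tensors of standard basis vectors, which
  are indexed by the multi-indices \<open>w :: 'n ^ 'd\<close>.\<close>

type_synonym ('a, 'n, 'd) tpow = "('a, ('n, 'd) vec) vec"

definition pure_tensor :: "'a::field ^ 'n ^ 'd \<Rightarrow> ('a, 'n, 'd) tpow" where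
  "pure_tensor v = (\<chi> w. \<Prod>k\<in>UNIV. v $ k $ (w $ k))"

text \<open>The left action moving the factor in position \<open>k\<close> to position \<open>\<sigma> k\<close>; see
  \<open>perm_action_pure_tensor\<close> below.\<close>

definition perm_action ::
  "('d \<Rightarrow> 'd) \<Rightarrow> ('a::field, 'n::finite, 'd::finite) tpow \<Rightarrow> ('a, 'n, 'd) tpow" where
  "perm_action \<sigma> t = (\<chi> w. t $ (\<chi> k. w $ \<sigma> k))"

definition sgn_perm_action ::
  "('d \<Rightarrow> 'd) \<Rightarrow> ('a::field, 'n::finite, 'd::finite) tpow \<Rightarrow> ('a, 'n, 'd) tpow" where
  "sgn_perm_action \<sigma> t = of_int (sign \<sigma>) *s perm_action \<sigma> t"

lemma perm_action_pure_tensor: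
  fixes v :: "'a::field ^ 'n ^ 'd"
  assumes "\<sigma> permutes UNIV"
  shows "perm_action \<sigma> (pure_tensor v) = pure_tensor (\<chi> k. v $ inv_into UNIV \<sigma> k)"
proof -
  have "(\<Prod>k\<in>UNIV. v $ k $ (w $ \<sigma> k)) = (\<Prod>k\<in>UNIV. v $ inv_into UNIV \<sigma> k $ (w $ k))" for w :: "'n ^ 'd"
    using prod.permute[OF assms, of "\<lambda>k. v $ inv_into UNIV \<sigma> k $ (w $ k)"] permutes_inverses[OF assms]
    by (simp add: o_def)
  then show ?thesis by (simp add: vec_eq_iff perm_action_def pure_tensor_def)
qed

lemma perm_action_id: "perm_action id t = t"
  by (simp add: perm_action_def vec_eq_iff)

lemma perm_action_comp: "perm_action (\<sigma> \<circ> \<tau>) t = perm_action \<sigma> (perm_action \<tau> t)"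
  by (simp add: perm_action_def vec_eq_iff)

text \<open>\<open>pure_tensor\<close> is the universal multilinear map on \<open>d\<close>-tuples of vectors.\<close>

definition multilinear :: "('a::field \<Rightarrow> 'b::ab_group_add \<Rightarrow> 'b) \<Rightarrow> ('a ^ 'n ^ 'd \<Rightarrow> 'b) \<Rightarrow> bool" where
  "multilinear scl m \<longleftrightarrow>
    (\<forall>v k. Vector_Spaces.linear (*s) scl (\<lambda>x. m (\<chi> l. if l = k then x else v $ l)))"

lemma pure_tensor_axis:
  fixes w :: "'n::finite ^ 'd"
  shows "pure_tensor (\<chi> k. axis (w $ k) (1::'a::field)) = axis w 1"
proof -
  have "(\<Prod>k\<in>UNIV. if u $ k = w $ k then 1 else 0) = (if u = w then 1 else (0::'a))" for u :: "'n ^ 'd"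
    by (auto simp: vec_eq_iff)
  then show ?thesis by (simp add: pure_tensor_def axis_def vec_eq_iff)
qed

lemma vec_basis_expansion:
  fixes x :: "'a::field ^ 'i"
  shows "x = (\<Sum>i\<in>UNIV. x $ i *s axis i 1)"
  by (simp add: vec_eq_iff axis_def if_distrib cong: if_cong)

lemma multilinear_pure_tensor:
  "multilinear (*s) (pure_tensor :: 'a::field ^ 'n ^ 'd \<Rightarrow> _)"
proof -
  have *: "(\<Prod>l\<in>UNIV. (if l = k then x else v $ l) $ (w $ l)) =
      x $ (w $ k) * (\<Prod>l\<in>UNIV-{k}. v $ l $ (w $ l))" for v :: "'a ^ 'n ^ 'd" and k x w
    by (subst prod.remove[of UNIV k]) (auto intro!: prod.cong)
  show ?thesis
    unfolding multilinear_def pure_tensor_def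
    by (auto intro!: Vector_Spaces.linear.intro vec.vector_space_axioms
      simp: Vector_Spaces.linear_iff vec_eq_iff * algebra_simps)
qed

lemma multilinear_eqI:
  fixes m m' :: "'a::field ^ 'n ^ 'd \<Rightarrow> 'b::ab_group_add"
  assumes m: "multilinear scl m" and m': "multilinear scl m'"
    and eq: "\<And>w :: 'n ^ 'd. m (\<chi> k. axis (w $ k) 1) = m' (\<chi> k. axis (w $ k) 1)"
  shows "m v = m' v"
proof -
  have "\<forall>v. (\<forall>k. k \<notin> K \<longrightarrow> (\<exists>i. v $ k = axis i 1)) \<longrightarrow> m v = m' v" if "finite K" for K
    using that
  proof (induction K)
    case empty
    show ?case
    proof (intro allI impI)
      fix v :: "'a ^ 'n ^ 'd" assume "\<forall>k. k \<notin> {} \<longrightarrow> (\<exists>i. v $ k = axis i 1)"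
      then obtain w where "\<And>k. v $ k = axis (w k) 1" by (metis empty_iff)
      then have "v = (\<chi> k. axis ((\<chi> k. w k) $ k) 1)" by (simp add: vec_eq_iff)
      then show "m v = m' v" using eq by metis
    qed
  next
    case (insert z K)
    show ?case
    proof (intro allI impI)
      fix v :: "'a ^ 'n ^ 'd" assume v: "\<forall>k. k \<notin> insert z K \<longrightarrow> (\<exists>i. v $ k = axis i 1)"
      define f where "f = (\<lambda>x. m (\<chi> l. if l = z then x else v $ l))"
      define f' where "f' = (\<lambda>x. m' (\<chi> l. if l = z then x else v $ l))"
      interpret f: Vector_Spaces.linear "(*s)" scl f using m by (simp add: multilinear_def f_def)
      interpret f': Vector_Spaces.linear "(*s)" scl f' using m' by (simp add: multilinear_def f'_def)
      have ax: "f (axis i 1) = f' (axis i 1)" for i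
        unfolding f_def f'_def using v by (intro insert.IH[rule_format]) auto
      have "f (v $ z) = f (\<Sum>i\<in>UNIV. v $ z $ i *s axis i 1)" by (simp flip: vec_basis_expansion)
      also have "\<dots> = f' (\<Sum>i\<in>UNIV. v $ z $ i *s axis i 1)"
        by (simp add: f.sum f'.sum f.scale f'.scale ax)
      also have "\<dots> = f' (v $ z)" by (simp flip: vec_basis_expansion)
      finally have "f (v $ z) = f' (v $ z)" .
      moreover have "(\<chi> l. if l = z then v $ z else v $ l) = v" by (simp add: vec_eq_iff)
      ultimately show "m v = m' v" by (simp add: f_def f'_def)
    qed
  qed
  from this[of UNIV] show ?thesis by simp
qed

proposition pure_tensor_universal:
  fixes m :: "'a::field ^ 'n ^ 'd \<Rightarrow> 'b::ab_group_add"
  assumes scl: "vector_space scl" and m: "multilinear scl m"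
  shows "\<exists>!L. Vector_Spaces.linear (*s) scl L \<and> (\<forall>v. L (pure_tensor v) = m v)"
proof -
  interpret B: vector_space scl by (fact scl)
  define L where "L t = (\<Sum>w\<in>UNIV. scl (t $ w) (m (\<chi> k. axis (w $ k) 1)))" for t
  have L: "Vector_Spaces.linear (*s) scl L"
    by (auto simp: Vector_Spaces.linear_iff L_def vec.vector_space_axioms scl
        B.scale_left_distrib sum.distrib B.scale_sum_right)
  have comp: "multilinear scl (\<lambda>v :: 'a ^ 'n ^ 'd. K (pure_tensor v))"
    if "Vector_Spaces.linear (*s) scl K" for K
    using multilinear_pure_tensor[where 'a='a and 'n='n and 'd='d] that
    unfolding multilinear_def
    using Vector_Spaces.linear_compose[unfolded o_def] by blast
  have ax: "L (axis w 1) = m (\<chi> k. axis (w $ k) 1)" for w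
  proof -
    have "L (axis w 1) = (\<Sum>u\<in>UNIV. if u = w then m (\<chi> k. axis (u $ k) 1) else 0)"
      unfolding L_def by (rule sum.cong) (auto simp: axis_def)
    then show ?thesis by simp
  qed
  have "L (pure_tensor v) = m v" for v
    by (rule multilinear_eqI[OF comp[OF L] m]) (simp add: pure_tensor_axis ax)
  moreover have "K = L" if K: "Vector_Spaces.linear (*s) scl K" "\<forall>v. K (pure_tensor v) = m v" for K
  proof
    fix t
    interpret K: Vector_Spaces.linear "(*s)" scl K by (fact K(1))
    have "K t = K (\<Sum>w\<in>UNIV. t $ w *s axis w 1)" by (simp flip: vec_basis_expansion)
    also have "\<dots> = L t"
      using K(2) by (simp add: K.sum K.scale L_def flip: pure_tensor_axis)
    finally show "K t = L t" .
  qed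
  ultimately show ?thesis using L by blast
qed


section \<open>The Schur algebra and its bimodule\<close>

definition equivariant_maps ::
  "(('d::finite \<Rightarrow> 'd) \<Rightarrow> 'a::field ^ 'i \<Rightarrow> 'a ^ 'i) \<Rightarrow> (('d \<Rightarrow> 'd) \<Rightarrow> 'a ^ 'j \<Rightarrow> 'a ^ 'j) \<Rightarrow>
    ('a ^ 'i \<Rightarrow> 'a ^ 'j) set" where
  "equivariant_maps \<rho> \<rho>' = {f. Vector_Spaces.linear (*s) (*s) f \<and>
    (\<forall>\<sigma>. \<sigma> permutes UNIV \<longrightarrow> (\<forall>t. f (\<rho> \<sigma> t) = \<rho>' \<sigma> (f t)))}"

text \<open>Algebras and modules over the field \<open>'a\<close> are represented by the record type \<open>module\<close>.
  (The locale \<open>algebra\<close> of HOL-Algebra is restricted to commutative algebras.)\<close>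

definition schur_algebra ::
  "('a::field, ('a, 'n::finite, 'd::finite) tpow \<Rightarrow> ('a, 'n, 'd) tpow) module" where
  "schur_algebra = \<lparr>
    carrier = equivariant_maps perm_action perm_action,
    mult = (\<lambda>x y. x \<circ> y), one = id,
    zero = (\<lambda>t. 0), add = (\<lambda>x y t. x t + y t),
    smult = (\<lambda>c x t. c *s x t)\<rparr>"

text \<open>\<open>S\<^sup>-\<close>.  The fields \<open>mult\<close> and \<open>one\<close> of the record have no meaning for a module.\<close>

definition schur_minus ::
  "('a::field, ('a, 'n::finite, 'd::finite) tpow \<Rightarrow> ('a, 'n, 'd) tpow) module" where
  "schur_minus = \<lparr>
    carrier = equivariant_maps perm_action sgn_perm_action,
    mult = undefined, one = undefined,
    zero = (\<lambda>t. 0), add = (\<lambda>x y t. x t + y t),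
    smult = (\<lambda>c x t. c *s x t)\<rparr>"

text \<open>Endomorphisms of \<open>M\<close> as a right \<open>R\<close>-module, where \<open>act y r\<close> is the product \<open>y r\<close>.  They are
  represented by extensional functions, so that equality is equality on \<open>carrier M\<close>.\<close>

definition right_module_End ::
  "('r, 'p) ring_scheme \<Rightarrow> ('m \<Rightarrow> 'r \<Rightarrow> 'm) \<Rightarrow> ('a, 'm, 'q) module_scheme \<Rightarrow>
    ('a, 'm \<Rightarrow> 'm) module" where
  "right_module_End R act M = \<lparr>
    carrier = {g \<in> carrier M \<rightarrow>\<^sub>E carrier M.
      (\<forall>y\<in>carrier M. \<forall>z\<in>carrier M. g (y \<oplus>\<^bsub>M\<^esub> z) = g y \<oplus>\<^bsub>M\<^esub> g z) \<and>
      (\<forall>y\<in>carrier M. \<forall>r\<in>carrier R. g (act y r) = act (g y) r)},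
    mult = (\<lambda>g h. \<lambda>y\<in>carrier M. g (h y)), one = (\<lambda>y\<in>carrier M. y),
    zero = (\<lambda>y\<in>carrier M. \<zero>\<^bsub>M\<^esub>), add = (\<lambda>g h. \<lambda>y\<in>carrier M. g y \<oplus>\<^bsub>M\<^esub> h y),
    smult = (\<lambda>c g. \<lambda>y\<in>carrier M. c \<odot>\<^bsub>M\<^esub> g y)\<rparr>"

definition schur_minus_End ::
  "('a::field, (('a, 'n::finite, 'd::finite) tpow \<Rightarrow> ('a, 'n, 'd) tpow) \<Rightarrow>
    (('a, 'n, 'd) tpow \<Rightarrow> ('a, 'n, 'd) tpow)) module" where
  "schur_minus_End = right_module_End schur_algebra (\<lambda>y s. y \<circ> s) schur_minus"

definition schur_psi ::
  "(('a::field, 'n::finite, 'd::finite) tpow \<Rightarrow> ('a, 'n, 'd) tpow) \<Rightarrow>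
    (('a, 'n, 'd) tpow \<Rightarrow> ('a, 'n, 'd) tpow) \<Rightarrow> (('a, 'n, 'd) tpow \<Rightarrow> ('a, 'n, 'd) tpow)" where
  "schur_psi x = (\<lambda>y\<in>carrier schur_minus. x \<circ> y)"

definition algebra_hom :: "('a, 'b, 'p) module_scheme \<Rightarrow> ('a, 'c, 'q) module_scheme \<Rightarrow> ('b \<Rightarrow> 'c) set" where
  "algebra_hom A B = {h \<in> ring_hom A B. \<forall>c. \<forall>x\<in>carrier A. h (c \<odot>\<^bsub>A\<^esub> x) = c \<odot>\<^bsub>B\<^esub> h x}"

definition algebra_iso :: "('a, 'b, 'p) module_scheme \<Rightarrow> ('a, 'c, 'q) module_scheme \<Rightarrow> ('b \<Rightarrow> 'c) set" where
  "algebra_iso A B = {h \<in> algebra_hom A B. bij_betw h (carrier A) (carrier B)}"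


section \<open>Well-definedness\<close>

lemma linear_vec_iff:
  "Vector_Spaces.linear (*s) (*s) (f :: 'a::field ^ 'i \<Rightarrow> 'a ^ 'j) \<longleftrightarrow>
    (\<forall>x y. f (x + y) = f x + f y) \<and> (\<forall>c x. f (c *s x) = c *s f x)"
  by (simp add: Vector_Spaces.linear_iff vec.vector_space_axioms)

lemma perm_action_linear: "Vector_Spaces.linear (*s) (*s) (perm_action \<sigma>)"
  by (simp add: linear_vec_iff perm_action_def vec_eq_iff)

lemma sgn_perm_action_linear: "Vector_Spaces.linear (*s) (*s) (sgn_perm_action \<sigma>)"
  by (simp add: linear_vec_iff sgn_perm_action_def perm_action_def vec_eq_iff algebra_simps)

lemma sgn_perm_action_comp:
  assumes "\<sigma> permutes (UNIV :: 'd::finite set)" "\<tau> permutes UNIV"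
  shows "sgn_perm_action (\<sigma> \<circ> \<tau>) t = sgn_perm_action \<sigma> (sgn_perm_action \<tau> t)"
proof -
  have "permutation \<sigma>" "permutation \<tau>" using assms by (auto simp: permutation_permutes)
  then show ?thesis
    by (simp add: sgn_perm_action_def perm_action_def vec_eq_iff sign_compose)
qed

lemma equivariant_comp:
  assumes "f \<in> equivariant_maps \<rho> \<rho>'" "g \<in> equivariant_maps \<rho>' \<rho>''"
  shows "g \<circ> f \<in> equivariant_maps \<rho> \<rho>''"
  using assms by (auto simp: equivariant_maps_def linear_vec_iff)

lemma equivariant_sgn:
  assumes "f \<in> equivariant_maps perm_action perm_action"
  shows "f \<in> equivariant_maps sgn_perm_action sgn_perm_action"
  using assms by (auto simp: equivariant_maps_def linear_vec_iff sgn_perm_action_def)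

lemma equivariant_add:
  assumes "\<And>\<sigma>. Vector_Spaces.linear (*s) (*s) (\<rho>' \<sigma>)"
    "f \<in> equivariant_maps \<rho> \<rho>'" "g \<in> equivariant_maps \<rho> \<rho>'"
  shows "(\<lambda>t. f t + g t) \<in> equivariant_maps \<rho> \<rho>'"
  using assms by (auto simp: equivariant_maps_def linear_vec_iff algebra_simps vector_add_ldistrib)

lemma equivariant_zero:
  assumes "\<And>\<sigma>. Vector_Spaces.linear (*s) (*s) (\<rho>' \<sigma>)"
  shows "(\<lambda>t. 0) \<in> equivariant_maps \<rho> \<rho>'"
  using assms by (auto simp: equivariant_maps_def linear_vec_iff) (metis vector_smult_lzero)

lemma equivariant_scale:
  assumes "\<And>\<sigma>. Vector_Spaces.linear (*s) (*s) (\<rho>' \<sigma>)" "f \<in> equivariant_maps \<rho> \<rho>'"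
  shows "(\<lambda>t. c *s f t) \<in> equivariant_maps \<rho> \<rho>'"
  using assms
  by (auto simp: equivariant_maps_def linear_vec_iff vector_add_ldistrib vector_smult_assoc mult.commute)

lemma ring_schur_algebra:
  "ring (schur_algebra :: ('a::field, ('a, 'n::finite, 'd::finite) tpow \<Rightarrow> _) module)"
  (is "ring ?S")
proof (rule ringI)
  note lin = perm_action_linear
  show "abelian_group ?S"
  proof (rule abelian_groupI)
    fix x assume x: "x \<in> carrier ?S"
    show "\<exists>y\<in>carrier ?S. y \<oplus>\<^bsub>?S\<^esub> x = \<zero>\<^bsub>?S\<^esub>"
      using x equivariant_scale[OF lin, where f = x and c = "-1"]
      by (intro bexI[of _ "\<lambda>t. (-1) *s x t"]) (auto simp: schur_algebra_def fun_eq_iff)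
  qed (auto simp: schur_algebra_def fun_eq_iff equivariant_add[OF lin] equivariant_zero[OF lin])
  show "monoid ?S"
    by (rule monoidI)
      (auto simp: schur_algebra_def o_assoc intro: equivariant_comp,
        auto simp: equivariant_maps_def linear_vec_iff)
qed (auto simp: schur_algebra_def fun_eq_iff equivariant_maps_def linear_vec_iff)

lemma schur_minus_bimodule:
  assumes "y \<in> carrier schur_minus" "s \<in> carrier schur_algebra"
  shows "s \<circ> y \<in> carrier schur_minus" "y \<circ> s \<in> carrier schur_minus"
  using assms by (auto simp: schur_minus_def schur_algebra_def intro: equivariant_comp equivariant_sgn)

lemma abelian_group_schur_minus:
  "abelian_group (schur_minus :: ('a::field, ('a, 'n::finite, 'd::finite) tpow \<Rightarrow> _) module)"
  (is "abelian_group ?M")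
proof (rule abelian_groupI)
  note lin = sgn_perm_action_linear
  fix x assume x: "x \<in> carrier ?M"
  show "\<exists>y\<in>carrier ?M. y \<oplus>\<^bsub>?M\<^esub> x = \<zero>\<^bsub>?M\<^esub>"
    using x equivariant_scale[OF lin, where f = x and c = "-1"]
    by (intro bexI[of _ "\<lambda>t. (-1) *s x t"]) (auto simp: schur_minus_def fun_eq_iff)
qed (auto simp: schur_minus_def fun_eq_iff
    equivariant_add[OF sgn_perm_action_linear] equivariant_zero[OF sgn_perm_action_linear])

lemma ring_right_module_End:
  assumes M: "abelian_group M"
    and closed: "\<And>y r. y \<in> carrier M \<Longrightarrow> r \<in> carrier R \<Longrightarrow> act y r \<in> carrier M"
    and distr: "\<And>y z r. y \<in> carrier M \<Longrightarrow> z \<in> carrier M \<Longrightarrow> r \<in> carrier R \<Longrightarrow>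
      act (y \<oplus>\<^bsub>M\<^esub> z) r = act y r \<oplus>\<^bsub>M\<^esub> act z r"
  shows "ring (right_module_End R act M)" (is "ring ?E")
proof -
  interpret M: abelian_group M by (fact M)
  have act_zero: "act \<zero>\<^bsub>M\<^esub> r = \<zero>\<^bsub>M\<^esub>" if "r \<in> carrier R" for r
    using distr[of "\<zero>\<^bsub>M\<^esub>" "\<zero>\<^bsub>M\<^esub>" r] closed[of "\<zero>\<^bsub>M\<^esub>" r] that
    by (metis M.zero_closed M.l_zero M.add.l_cancel_one)
  have act_neg: "act (\<ominus>\<^bsub>M\<^esub> y) r = \<ominus>\<^bsub>M\<^esub> act y r" if "y \<in> carrier M" "r \<in> carrier R" for y r
    using distr[of "\<ominus>\<^bsub>M\<^esub> y" y r] act_zero closed that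
    by (metis M.a_inv_closed M.l_neg M.minus_equality)
  show ?thesis
  proof (rule ringI)
    show "abelian_group ?E"
    proof (rule abelian_groupI)
      fix g assume g: "g \<in> carrier ?E"
      show "\<exists>h\<in>carrier ?E. h \<oplus>\<^bsub>?E\<^esub> g = \<zero>\<^bsub>?E\<^esub>"
        using g by (intro bexI[of _ "\<lambda>y\<in>carrier M. \<ominus>\<^bsub>M\<^esub> g y"])
          (auto simp: right_module_End_def closed act_neg M.minus_add M.l_neg PiE_iff
            cong: restrict_cong)
    qed (auto simp: right_module_End_def closed distr act_zero PiE_iff M.a_ac fun_eq_iff
        extensional_def)
    show "monoid ?E"
      by (rule monoidI) (auto simp: right_module_End_def closed PiE_iff fun_eq_iff extensional_def)
  qed (auto simp: right_module_End_def PiE_iff fun_eq_iff)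
qed

lemma ring_schur_minus_End:
  "ring (schur_minus_End :: ('a::field, (('a, 'n::finite, 'd::finite) tpow \<Rightarrow> _) \<Rightarrow> _) module)"
  unfolding schur_minus_End_def
  by (rule ring_right_module_End)
    (simp_all add: abelian_group_schur_minus schur_minus_bimodule,
      simp add: schur_minus_def fun_eq_iff)

proposition schur_psi_algebra_hom:
  "(schur_psi :: (('a::field, 'n::finite, 'd::finite) tpow \<Rightarrow> _) \<Rightarrow> _)
    \<in> algebra_hom schur_algebra schur_minus_End"
  (is "?psi \<in> _")
  unfolding algebra_hom_def
proof (intro CollectI conjI ballI allI)
  show "?psi \<in> ring_hom schur_algebra schur_minus_End"
  proof (rule ring_hom_memI)
    fix x :: "('a, 'n, 'd) tpow \<Rightarrow> ('a, 'n, 'd) tpow" assume x: "x \<in> carrier schur_algebra"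
    have lin: "x (s + t) = x s + x t" for s t
      using x by (simp add: schur_algebra_def equivariant_maps_def linear_vec_iff)
    interpret M: abelian_group "schur_minus :: ('a, ('a, 'n, 'd) tpow \<Rightarrow> _) module"
      by (rule abelian_group_schur_minus)
    have "x \<circ> (y \<oplus>\<^bsub>schur_minus\<^esub> z) = (x \<circ> y) \<oplus>\<^bsub>schur_minus\<^esub> (x \<circ> z)" for y z
      by (simp add: schur_minus_def lin fun_eq_iff)
    then show "schur_psi x \<in> carrier schur_minus_End"
      using x M.a_closed
      by (auto simp: schur_minus_End_def right_module_End_def schur_psi_def schur_minus_bimodule
          o_assoc)
  next
    fix x y :: "('a, 'n, 'd) tpow \<Rightarrow> ('a, 'n, 'd) tpow"
    assume "x \<in> carrier schur_algebra" "y \<in> carrier schur_algebra"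
    then show "schur_psi (x \<otimes>\<^bsub>schur_algebra\<^esub> y) = schur_psi x \<otimes>\<^bsub>schur_minus_End\<^esub> schur_psi y"
      by (auto simp: schur_minus_End_def right_module_End_def schur_psi_def fun_eq_iff
          schur_minus_bimodule) (auto simp: schur_algebra_def)
  qed (auto simp: schur_minus_End_def right_module_End_def schur_psi_def fun_eq_iff
      schur_algebra_def schur_minus_def)
qed (auto simp: schur_minus_End_def right_module_End_def schur_psi_def fun_eq_iff
    schur_algebra_def schur_minus_def)

end

theory Submission
  imports Defs
begin

text \<open>Write \<open>E\<close> for the tensor power, and \<open>E\<^sup>-\<close> for \<open>E\<close> twisted by the sign.

  If \<open>n \<ge> d\<close>, choose a multi-index \<open>w\<close> with pairwise distinct entries.  Its basis tensor \<open>e\<close> generates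
  a free summand of \<open>E\<close>, so every vector \<open>t\<close> of a representation is the image of \<open>e\<close> under an
  equivariant map \<open>free_map\<close> that kills the basis tensors outside the orbit of \<open>e\<close>
  (\<open>free_map_equivariant\<close>, \<open>free_map_axis\<close>).  Let \<open>y\<^sub>t : E \<rightarrow> E\<^sup>-\<close> and \<open>s\<^sub>t : E \<rightarrow> E\<close> be these maps.
  If \<open>x \<circ> y = x' \<circ> y\<close> for all \<open>y\<close>, evaluating at \<open>y = y\<^sub>t\<close> and \<open>e\<close> gives \<open>x t = x' t\<close>; this is
  injectivity.  Given a right module endomorphism \<open>g\<close>, put \<open>x t = g y\<^sub>t e\<close>.  Since
  \<open>y \<circ> s\<^sub>u = y\<^bsub>y u\<^esub>\<close> (\<open>comp_free_map\<close>), \<open>x (y u) = g (y \<circ> s\<^sub>u) e = g y (s\<^sub>u e) = g y u\<close>, that is,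
  \<open>\<psi> x = g\<close>.  The same identity for \<open>y = y\<^sub>t\<close> and \<open>u\<close> a multiple of \<open>e\<close> or of a permuted \<open>e\<close>
  shows that \<open>x\<close> is homogeneous and equivariant, and \<open>x\<close> is additive because \<open>g\<close> and
  \<open>t \<mapsto> y\<^sub>t\<close> are.

  If \<open>n < d\<close>, the projection of \<open>E\<close> onto the line spanned by a tensor \<open>e\<^sub>i \<otimes> \<dots> \<otimes> e\<^sub>i\<close> is a nonzero
  element of the Schur algebra that kills \<open>S\<^sup>-\<close>: each multi-index has a repeated
  entry, so its basis tensor is fixed by a transposition, while this transposition acts on the
  projected line in \<open>E\<^sup>-\<close> as \<open>-1\<close>.  Hence an element of \<open>S\<^sup>-\<close> followed by the projection sends the
  basis tensor to a multiple \<open>c\<close> of \<open>e\<^sub>i \<otimes> \<dots> \<otimes> e\<^sub>i\<close> with \<open>c = -c\<close>, so \<open>c = 0\<close>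
  in characteristic different from \<open>2\<close>.\<close>

section \<open>Equivariant maps out of a free orbit\<close>

lemma equivariant_maps_axis_expansion:
  assumes "f \<in> equivariant_maps \<rho> \<rho>'"
  shows "f s = (\<Sum>w\<in>UNIV. s $ w *s f (axis w 1))"
proof -
  interpret f: Vector_Spaces.linear "(*s)" "(*s)" f
    using assms by (simp add: equivariant_maps_def)
  have "f s = f (\<Sum>w\<in>UNIV. s $ w *s axis w 1)" by (simp flip: vec_basis_expansion)
  then show ?thesis by (simp add: f.sum f.scale)
qed

lemma perm_action_axis:
  assumes "(\<chi> k. w $ \<sigma> k) = w" and "\<sigma> permutes UNIV"
  shows "perm_action \<sigma> (axis w 1) = (axis w 1 :: ('a::field, 'n::finite, 'd::finite) tpow)"
proof -
  have "(\<chi> k. u $ \<sigma> k) = w \<longleftrightarrow> u = w" for u :: "'n ^ 'd"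
  proof -
    have "(\<chi> k. u $ \<sigma> k) = (\<chi> k. w $ \<sigma> k) \<longleftrightarrow> u = w"
      using permutes_surj[OF assms(2)] by (simp add: vec_eq_iff) (metis surj_def)
    then show ?thesis by (simp only: assms(1))
  qed
  then show ?thesis by (simp add: perm_action_def axis_def vec_eq_iff)
qed

text \<open>The linear map that sends the basis tensor at \<open>w \<circ> \<sigma>\<close> to \<open>\<rho> \<sigma>\<^sup>-\<^sup>1 t\<close> for every permutation
  \<open>\<sigma>\<close>, and all other basis tensors to \<open>0\<close>.  This description presupposes that the entries of
  \<open>w\<close> are distinct; in general the values for equal \<open>w \<circ> \<sigma>\<close> are added up.\<close>

definition free_map ::
  "'n ^ 'd \<Rightarrow> (('d::finite \<Rightarrow> 'd) \<Rightarrow> 'a ^ 'j \<Rightarrow> 'a ^ 'j) \<Rightarrow> 'a ^ 'j \<Rightarrow>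
    ('a::field, 'n::finite, 'd) tpow \<Rightarrow> 'a ^ 'j" where
  "free_map w \<rho> t s = (\<Sum>\<sigma> | \<sigma> permutes UNIV. s $ (\<chi> k. w $ \<sigma> k) *s \<rho> (inv_into UNIV \<sigma>) t)"

lemma free_map_linear: "Vector_Spaces.linear (*s) (*s) (free_map w \<rho> t)"
  by (simp add: linear_vec_iff free_map_def sum.distrib vector_sadd_rdistrib vec.scale_sum_right)

lemma free_map_equivariant:
  fixes w :: "'n::finite ^ 'd::finite"
    and \<rho> :: "('d \<Rightarrow> 'd) \<Rightarrow> 'a::field ^ 'j \<Rightarrow> 'a ^ 'j"
  assumes lin: "\<And>\<sigma>. Vector_Spaces.linear (*s) (*s) (\<rho> \<sigma>)"
    and comp: "\<And>\<sigma> \<tau> t. \<sigma> permutes UNIV \<Longrightarrow> \<tau> permutes UNIV \<Longrightarrow> \<rho> (\<sigma> \<circ> \<tau>) t = \<rho> \<sigma> (\<rho> \<tau> t)"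
  shows "free_map w \<rho> t \<in> equivariant_maps perm_action \<rho>"
  unfolding equivariant_maps_def
proof (intro CollectI conjI allI impI free_map_linear)
  fix \<tau> :: "'d \<Rightarrow> 'd" and s
  assume \<tau>: "\<tau> permutes UNIV"
  interpret \<tau>: Vector_Spaces.linear "(*s)" "(*s)" "\<rho> \<tau>" by (fact lin)
  have inv: "\<rho> (inv_into UNIV \<sigma>) t = \<rho> \<tau> (\<rho> (inv_into UNIV (\<sigma> \<circ> \<tau>)) t)" if "\<sigma> permutes UNIV" for \<sigma>
  proof -
    have "inv_into UNIV \<sigma> = \<tau> \<circ> inv_into UNIV (\<sigma> \<circ> \<tau>)"
      using \<tau> that by (simp add: o_inv_distrib permutes_bij permutes_inv_o o_assoc)
    then show ?thesis
      using comp[OF \<tau> permutes_inv[OF permutes_compose[OF \<tau> that]]] by simp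
  qed
  have "free_map w \<rho> t (perm_action \<tau> s) =
      (\<Sum>\<sigma> | \<sigma> permutes UNIV. s $ (\<chi> k. w $ (\<sigma> \<circ> \<tau>) k) *s \<rho> \<tau> (\<rho> (inv_into UNIV (\<sigma> \<circ> \<tau>)) t))"
    unfolding free_map_def by (rule sum.cong) (simp_all add: perm_action_def flip: inv)
  also have "\<dots> = (\<Sum>\<sigma> | \<sigma> permutes UNIV. s $ (\<chi> k. w $ \<sigma> k) *s \<rho> \<tau> (\<rho> (inv_into UNIV \<sigma>) t))"
    by (rule sum_permutations_compose_right[OF \<tau>, symmetric])
  also have "\<dots> = \<rho> \<tau> (free_map w \<rho> t s)"
    by (simp add: free_map_def \<tau>.sum \<tau>.scale)
  finally show "free_map w \<rho> t (perm_action \<tau> s) = \<rho> \<tau> (free_map w \<rho> t s)" .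
qed

lemma free_map_axis:
  assumes w: "inj (($) w)" and id: "\<rho> id t = t"
  shows "free_map w \<rho> t (axis w 1) = t"
proof -
  have "(\<chi> k. w $ \<sigma> k) = w \<longleftrightarrow> \<sigma> = id" for \<sigma>
    using inj_eq[OF w] by (auto simp: vec_eq_iff fun_eq_iff)
  then have "free_map w \<rho> t (axis w 1) =
      (\<Sum>\<sigma> | \<sigma> permutes UNIV. if \<sigma> = id then \<rho> (inv_into UNIV \<sigma>) t else 0)"
    unfolding free_map_def by (intro sum.cong) (auto simp: axis_def)
  also have "\<dots> = t"
    by (simp add: finite_permutations permutes_id id)
  finally show ?thesis .
qed

lemma comp_free_map:
  assumes f: "f \<in> equivariant_maps \<rho> \<rho>'"
  shows "f \<circ> free_map w \<rho> u = free_map w \<rho>' (f u)"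
proof -
  interpret f: Vector_Spaces.linear "(*s)" "(*s)" f
    using f by (simp add: equivariant_maps_def)
  have "f (\<rho> (inv_into UNIV \<sigma>) u) = \<rho>' (inv_into UNIV \<sigma>) (f u)" if "\<sigma> permutes UNIV" for \<sigma>
    using f permutes_inv[OF that] by (simp add: equivariant_maps_def)
  then show ?thesis
    by (simp add: free_map_def fun_eq_iff f.sum f.scale)
qed

lemma free_map_add:
  assumes "\<And>\<sigma>. Vector_Spaces.linear (*s) (*s) (\<rho> \<sigma>)"
  shows "free_map w \<rho> (t + t') = (\<lambda>s. free_map w \<rho> t s + free_map w \<rho> t' s)"
  using assms
  by (simp add: free_map_def fun_eq_iff linear_vec_iff sum.distrib vector_add_ldistrib)

section \<open>The case \<open>n \<ge> d\<close>\<close>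

context
  fixes w :: "'n::finite ^ 'd::finite"
  assumes inj_w: "inj (($) w)"
begin

lemma free_map_schur_algebra:
  "free_map w perm_action u \<in> carrier (schur_algebra :: ('a::field, ('a, 'n, 'd) tpow \<Rightarrow> _) module)"
  by (simp add: schur_algebra_def free_map_equivariant perm_action_linear perm_action_comp)

lemma free_map_schur_minus:
  "free_map w sgn_perm_action t \<in> carrier (schur_minus :: ('a::field, ('a, 'n, 'd) tpow \<Rightarrow> _) module)"
  by (simp add: schur_minus_def free_map_equivariant sgn_perm_action_linear sgn_perm_action_comp)

lemma free_map_axis_perm: "free_map w perm_action t (axis w 1) = (t :: ('a::field, 'n, 'd) tpow)"
  by (rule free_map_axis[OF inj_w]) (rule perm_action_id)

lemma free_map_axis_sgn: "free_map w sgn_perm_action t (axis w 1) = (t :: ('a::field, 'n, 'd) tpow)"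
  by (rule free_map_axis[OF inj_w]) (simp add: sgn_perm_action_def perm_action_id)

lemma inj_on_schur_psi:
  "inj_on schur_psi (carrier (schur_algebra :: ('a::field, ('a, 'n, 'd) tpow \<Rightarrow> _) module))"
proof (rule inj_onI, rule ext)
  fix x x' :: "('a, 'n, 'd) tpow \<Rightarrow> ('a, 'n, 'd) tpow" and t
  assume "schur_psi x = schur_psi x'"
  then have "schur_psi x (free_map w sgn_perm_action t) = schur_psi x' (free_map w sgn_perm_action t)"
    by simp
  then have "x (free_map w sgn_perm_action t (axis w 1)) = x' (free_map w sgn_perm_action t (axis w 1))"
    by (simp add: schur_psi_def free_map_schur_minus fun_eq_iff)
  then show "x t = x' t" by (simp add: free_map_axis_sgn)
qed

lemma schur_psi_surjective:
  fixes g :: "(('a::field, 'n, 'd) tpow \<Rightarrow> ('a, 'n, 'd) tpow) \<Rightarrow> _"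
  assumes g: "g \<in> carrier schur_minus_End"
  shows "g \<in> schur_psi ` carrier schur_algebra"
proof -
  let ?e = "axis w 1 :: ('a, 'n, 'd) tpow"
  let ?y = "free_map w sgn_perm_action :: ('a, 'n, 'd) tpow \<Rightarrow> _"
  let ?s = "free_map w perm_action :: ('a, 'n, 'd) tpow \<Rightarrow> _"
  define x where "x t = g (?y t) ?e" for t
  have g_ext: "g \<in> extensional (carrier schur_minus)"
    using g by (auto simp: schur_minus_End_def right_module_End_def PiE_iff)
  have g_closed: "g y \<in> carrier schur_minus" if "y \<in> carrier schur_minus" for y
    using g that by (auto simp: schur_minus_End_def right_module_End_def)
  have g_add: "g (\<lambda>t. y t + z t) = (\<lambda>t. g y t + g z t)"
    if "y \<in> carrier schur_minus" "z \<in> carrier schur_minus" for y z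
    using g that by (simp add: schur_minus_End_def right_module_End_def) (simp add: schur_minus_def)
  have g_comp: "g (y \<circ> r) = g y \<circ> r" if "y \<in> carrier schur_minus" "r \<in> carrier schur_algebra" for y r
    using g that by (simp add: schur_minus_End_def right_module_End_def)
  have x_comp: "x (y u) = g y u" if y: "y \<in> carrier schur_minus" for y u
  proof -
    have "?y (y u) = y \<circ> ?s u"
      using y by (simp add: comp_free_map schur_minus_def)
    then have "x (y u) = g y (?s u ?e)"
      by (simp add: x_def g_comp[OF y free_map_schur_algebra])
    then show ?thesis by (simp add: free_map_axis_perm)
  qed
  have minus: "y (c *s t) = c *s y t" "\<sigma> permutes UNIV \<Longrightarrow> y (perm_action \<sigma> t) = sgn_perm_action \<sigma> (y t)"
    if "y \<in> carrier schur_minus" for y :: "('a, 'n, 'd) tpow \<Rightarrow> ('a, 'n, 'd) tpow" and c t \<sigma>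
    using that by (simp_all add: schur_minus_def equivariant_maps_def linear_vec_iff)
  have x_add: "x (t + t') = x t + x t'" for t t'
    by (simp add: x_def free_map_add sgn_perm_action_linear g_add free_map_schur_minus)
  have x_scale: "x (c *s t) = c *s x t" for c t
    using x_comp[OF free_map_schur_minus, of t "c *s ?e"]
    by (simp add: minus(1)[OF g_closed[OF free_map_schur_minus]] minus(1)[OF free_map_schur_minus]
          free_map_axis_sgn x_def)
  have x_perm: "x (perm_action \<sigma> t) = perm_action \<sigma> (x t)" if \<sigma>: "\<sigma> permutes UNIV" for \<sigma> t
  proof -
    \<comment> \<open>The scalar \<open>sign \<sigma>\<close> cancels the sign in the twisted action.\<close>
    let ?u = "of_int (sign \<sigma>) *s perm_action \<sigma> ?e"
    have "y ?u = perm_action \<sigma> (y ?e)" if "y \<in> carrier schur_minus" for y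
      by (simp add: minus(1)[OF that] minus(2)[OF that \<sigma>] sgn_perm_action_def vector_smult_assoc
          sign_idempotent flip: of_int_mult)
    from this[OF free_map_schur_minus] this[OF g_closed[OF free_map_schur_minus]] show ?thesis
      using x_comp[OF free_map_schur_minus, of t ?u] by (simp add: free_map_axis_sgn x_def)
  qed
  have "x \<in> carrier schur_algebra"
    by (simp add: schur_algebra_def equivariant_maps_def linear_vec_iff x_add x_scale x_perm)
  moreover have "schur_psi x = g"
  proof (rule extensionalityI)
    show "schur_psi x \<in> extensional (carrier schur_minus)" by (simp add: schur_psi_def)
    show "g \<in> extensional (carrier schur_minus)" by (fact g_ext)
    show "schur_psi x y = g y" if "y \<in> carrier schur_minus" for y
      using x_comp[OF that] that by (auto simp: schur_psi_def)
  qed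
  ultimately show ?thesis by blast
qed

end

section \<open>The case \<open>n < d\<close>\<close>

lemma schur_minus_const_coordinate:
  fixes y :: "('a::field, 'n::finite, 'd::finite) tpow \<Rightarrow> ('a, 'n, 'd) tpow"
  assumes char: "CHAR('a) \<noteq> 2" and less: "CARD('n) < CARD('d)"
    and y: "y \<in> carrier schur_minus"
  shows "y s $ (\<chi> k. i) = 0"
proof -
  have eq: "y \<in> equivariant_maps perm_action sgn_perm_action"
    using y by (simp add: schur_minus_def)
  have "y (axis w 1) $ (\<chi> k. i) = 0" for w
  proof -
    have "\<not> inj (($) w)"
      using card_inj_on_le[of "($) w" UNIV UNIV] less by auto
    then obtain a b where ab: "a \<noteq> b" "w $ a = w $ b" by (auto simp: inj_def)
    let ?\<tau> = "Transposition.transpose a b"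
    have perm: "?\<tau> permutes UNIV" by (simp add: permutes_swap_id)
    have w: "(\<chi> k. w $ ?\<tau> k) = w"
      using ab by (simp add: vec_eq_iff Transposition.transpose_def)
    have "y (axis w 1) = y (perm_action ?\<tau> (axis w 1))"
      by (simp only: perm_action_axis[OF w perm])
    also have "\<dots> = sgn_perm_action ?\<tau> (y (axis w 1))"
      using eq perm by (simp add: equivariant_maps_def)
    finally have "y (axis w 1) $ (\<chi> k. i) = sgn_perm_action ?\<tau> (y (axis w 1)) $ (\<chi> k. i)"
      by (rule arg_cong)
    also have "\<dots> = - (y (axis w 1) $ (\<chi> k. i))"
      using ab(1) by (simp add: sgn_perm_action_def perm_action_def sign_swap_id)
    finally have "y (axis w 1) $ (\<chi> k. i) + y (axis w 1) $ (\<chi> k. i) = 0"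
      by (simp only: eq_neg_iff_add_eq_0)
    then have "of_nat 2 * (y (axis w 1) $ (\<chi> k. i)) = 0"
      by (simp only: of_nat_numeral mult_2)
    moreover have "of_nat 2 \<noteq> (0::'a)"
    proof
      assume "of_nat 2 = (0::'a)"
      then have "CHAR('a) dvd 2" by (simp only: of_nat_eq_0_iff_char_dvd)
      then have "CHAR('a) \<le> 2" "CHAR('a) \<noteq> 0" by (auto dest: dvd_imp_le intro!: gr0I)
      with char CHAR_not_1[where 'a = 'a] show False by linarith
    qed
    ultimately show ?thesis by (metis mult_eq_0_iff)
  qed
  then show ?thesis
    by (subst equivariant_maps_axis_expansion[OF eq]) simp
qed

lemma not_inj_on_schur_psi:
  assumes "CHAR('a::field) \<noteq> 2" and "CARD('n::finite) < CARD('d::finite)"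
  shows "\<not> inj_on schur_psi (carrier (schur_algebra :: ('a, ('a, 'n, 'd) tpow \<Rightarrow> _) module))"
proof
  assume inj: "inj_on schur_psi (carrier (schur_algebra :: ('a, ('a, 'n, 'd) tpow \<Rightarrow> _) module))"
  fix i :: 'n
  define w :: "'n ^ 'd" where "w = (\<chi> k. i)"
  let ?x = "\<lambda>t. (t $ w) *s axis w 1 :: ('a, 'n, 'd) tpow"
  have w: "(\<chi> k. w $ \<sigma> k) = w" for \<sigma> by (simp add: w_def)
  have "?x (perm_action \<sigma> t) = perm_action \<sigma> (?x t)" if "\<sigma> permutes UNIV" for \<sigma> t
  proof -
    interpret \<sigma>: Vector_Spaces.linear "(*s)" "(*s)" "perm_action \<sigma> :: ('a, 'n, 'd) tpow \<Rightarrow> _"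
      by (fact perm_action_linear)
    have "perm_action \<sigma> t $ w = t $ w" by (simp add: perm_action_def w)
    then show ?thesis by (simp add: \<sigma>.scale perm_action_axis[OF w that])
  qed
  then have x: "?x \<in> carrier schur_algebra"
    by (simp add: schur_algebra_def equivariant_maps_def linear_vec_iff vector_sadd_rdistrib)
  have zero: "(\<lambda>t. 0) \<in> carrier (schur_algebra :: ('a, ('a, 'n, 'd) tpow \<Rightarrow> _) module)"
    by (simp add: schur_algebra_def equivariant_zero perm_action_linear)
  have "schur_psi ?x = schur_psi (\<lambda>t. 0)"
    unfolding schur_psi_def
    by (intro restrict_ext) (simp add: fun_eq_iff w_def schur_minus_const_coordinate[OF assms])
  then have "?x = (\<lambda>t. 0)" using inj x zero by (blast dest: inj_onD)
  then have "?x (axis w 1) $ w = 0" by (simp add: fun_eq_iff)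
  then show False by (simp add: axis_def)
qed

section \<open>The isomorphism criterion\<close>

theorem theorem4p7:
  assumes "CHAR('a::field) \<noteq> 2"
  shows "(schur_psi :: (('a, 'n::finite, 'd::finite) tpow \<Rightarrow> ('a, 'n, 'd) tpow) \<Rightarrow> _)
      \<in> algebra_iso schur_algebra schur_minus_End
    \<longleftrightarrow> CARD('n) \<ge> CARD('d)"
proof
  assume "(schur_psi :: (('a, 'n, 'd) tpow \<Rightarrow> ('a, 'n, 'd) tpow) \<Rightarrow> _)
      \<in> algebra_iso schur_algebra schur_minus_End"
  then have "inj_on schur_psi (carrier (schur_algebra :: ('a, ('a, 'n, 'd) tpow \<Rightarrow> _) module))"
    by (simp add: algebra_iso_def bij_betw_def)
  then show "CARD('n) \<ge> CARD('d)"
    using not_inj_on_schur_psi[OF assms, where 'n = 'n and 'd = 'd] by linarith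
next
  assume "CARD('n) \<ge> CARD('d)"
  then obtain \<iota> :: "'d \<Rightarrow> 'n" where "inj \<iota>"
    using card_le_inj[of "UNIV :: 'd set" "UNIV :: 'n set"] by auto
  then have w: "inj (($) (\<chi> k. \<iota> k))" by (simp add: inj_def)
  have hom: "(schur_psi :: (('a, 'n, 'd) tpow \<Rightarrow> ('a, 'n, 'd) tpow) \<Rightarrow> _)
      \<in> algebra_hom schur_algebra schur_minus_End"
    by (rule schur_psi_algebra_hom)
  then have "(schur_psi :: (('a, 'n, 'd) tpow \<Rightarrow> ('a, 'n, 'd) tpow) \<Rightarrow> _)
      \<in> carrier schur_algebra \<rightarrow> carrier schur_minus_End"
    by (auto simp: algebra_hom_def ring_hom_def)
  then have "bij_betw (schur_psi :: (('a, 'n, 'd) tpow \<Rightarrow> ('a, 'n, 'd) tpow) \<Rightarrow> _)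
      (carrier schur_algebra) (carrier schur_minus_End)"
    using inj_on_schur_psi[OF w] schur_psi_surjective[OF w] by (auto simp: bij_betw_def)
  with hom show "(schur_psi :: (('a, 'n, 'd) tpow \<Rightarrow> ('a, 'n, 'd) tpow) \<Rightarrow> _)
      \<in> algebra_iso schur_algebra schur_minus_End"
    by (simp add: algebra_iso_def)
qed

end
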